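(* Let $\mathcal F$ be a cellular sheaf on a finite connected graph $B$ with all stalks equal to $\mathbb R^n$ and restriction maps $\rho_{i,e}\in O(n)$ (for each vertex $i$ incident to an edge $e$), so that the coboundary is $(\delta_{\mathcal F}z)_e=\rho_{j,e}z_j-\rho_{i,e}z_i$ for each edge $e=(i,j)$. Let $L_{\mathcal F}=\delta_{\mathcal F}^{*}W\delta_{\mathcal F}$ with $W$ positive definite. Fix a base vertex $v_0$ and let $\mathrm{Hol}(\mathcal F,v_0)\subseteq O(n)$ be the group generated by the holonomies of all cycles based at $v_0$. Then $$\dim\ker L_{\mathcal F}=\dim\mathrm{Fix}\bigl(\mathrm{Hol}(\mathcal F,v_0)\bigr),$$ where $\mathrm{Fix}(\mathrm{Hol}(\mathcal F,v_0))$ is the subspace of $\mathbb R^n$ fixed pointwise by $\mathrm{Hol}(\mathcal F,v_0)$. In particular: if all restriction maps are the identity, the holonomy is trivial and $\dim\ker L_{\mathcal F}=n$ (per connected component); whereas a single cycle with nontrivial holonomy can force $\dim\ker L_{\mathcal F}=0$, i.e. there exist such sheaves on a connected graph consisting of a single cycle, with nontrivial holonomy, that admit no nonzero global section.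
   Context: The graph has finite vertex and edge sets, each edge given an orientation $e=(i,j)$. $C^0=\bigoplus_{\text{vertices}}\mathbb R^n$, $C^1=\bigoplus_{\text{edges}}\mathbb R^n$ with the standard inner products; $\delta_{\mathcal F}\colon C^0\to C^1$; $W$ is a positive definite linear operator on $C^1$; $\delta_{\mathcal F}^*$ is the adjoint. A global section is an element of $\ker\delta_{\mathcal F}$, i.e. $z\in C^0$ with $\rho_{i,e}z_i=\rho_{j,e}z_j$ for every edge $e=(i,j)$. Parallel transport along an edge $e$ from $i$ to $j$ is $\rho_{j,e}^{-1}\rho_{i,e}\in O(n)$ (and its inverse when traversed from $j$ to $i$); along a walk it is the composite of the transports along its edges. The holonomy of a cycle based at $v_0$ (a closed walk starting and ending at $v_0$) is the parallel transport along it. *)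

theory Defs
  imports
    "HOL-Analysis.Analysis"
    "HOL-Algebra.Generated_Groups"
    "Graph_Theory.Digraph_Component"
begin

section \<open>Sheaves with orthogonal restriction maps\<close>

text \<open>
  A graph with oriented edges is a \<^typ>\<open>('v, 'e) pre_digraph\<close>; an edge \<open>e = (i, j)\<close> has
  tail \<open>i\<close> and head \<open>j\<close>. The matrix \<open>\<rho> i e\<close> is the restriction map from the stalk at the
  vertex \<open>i\<close> to the stalk at the edge \<open>e\<close>; it is relevant only when \<open>i\<close> is incident to \<open>e\<close>.
\<close>

type_synonym ('n, 'v, 'e) restrictions = "'v \<Rightarrow> 'e \<Rightarrow> real^'n^'n"

definition orthogonal_sheaf ::
    "('v, 'e) pre_digraph \<Rightarrow> ('n::finite, 'v, 'e) restrictions \<Rightarrow> bool" where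
  "orthogonal_sheaf G \<rho> \<longleftrightarrow>
     (\<forall>e\<in>arcs G. orthogonal_matrix (\<rho> (tail G e) e) \<and> orthogonal_matrix (\<rho> (head G e) e))"

definition identity_sheaf ::
    "('v, 'e) pre_digraph \<Rightarrow> ('n::finite, 'v, 'e) restrictions \<Rightarrow> bool" where
  "identity_sheaf G \<rho> \<longleftrightarrow>
     (\<forall>e\<in>arcs G. \<rho> (tail G e) e = mat 1 \<and> \<rho> (head G e) e = mat 1)"

text \<open>
  The vertex and edge sets need not exhaust the finite types \<^typ>\<open>'v\<close> and \<^typ>\<open>'e\<close> (in
  particular there may be no edges), so the cochain spaces are the subspaces of families
  supported on \<^term>\<open>verts G\<close> and \<^term>\<open>arcs G\<close>, with the inherited standard inner products.
\<close>

definition C0 :: "('v::finite, 'e) pre_digraph \<Rightarrow> (real^'n::finite^'v) set" where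
  "C0 G = {z. \<forall>v. v \<notin> verts G \<longrightarrow> z $ v = 0}"

definition C1 :: "('v, 'e::finite) pre_digraph \<Rightarrow> (real^'n::finite^'e) set" where
  "C1 G = {y. \<forall>e. e \<notin> arcs G \<longrightarrow> y $ e = 0}"

definition coboundary ::
    "('v::finite, 'e::finite) pre_digraph \<Rightarrow> ('n::finite, 'v, 'e) restrictions
      \<Rightarrow> real^'n^'v \<Rightarrow> real^'n^'e" where
  "coboundary G \<rho> z =
     (\<chi> e. if e \<in> arcs G
           then \<rho> (head G e) e *v (z $ head G e) - \<rho> (tail G e) e *v (z $ tail G e)
           else 0)"

definition global_sections ::
    "('v::finite, 'e::finite) pre_digraph \<Rightarrow> ('n::finite, 'v, 'e) restrictions
      \<Rightarrow> (real^'n^'v) set" where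
  "global_sections G \<rho> = {z \<in> C0 G. coboundary G \<rho> z = 0}"

text \<open>
  Positive definite includes self-adjoint. Every linear operator on \<^term>\<open>C1 G\<close> is the
  restriction of a linear map on the ambient space, so \<^term>\<open>linear W\<close> loses no generality.
\<close>

definition pos_def_on_C1 ::
    "('v, 'e::finite) pre_digraph \<Rightarrow> (real^'n::finite^'e \<Rightarrow> real^'n^'e) \<Rightarrow> bool" where
  "pos_def_on_C1 G W \<longleftrightarrow>
     linear W \<and> W ` C1 G \<subseteq> C1 G \<and>
     (\<forall>x\<in>C1 G. \<forall>y\<in>C1 G. W x \<bullet> y = x \<bullet> W y) \<and>
     (\<forall>x\<in>C1 G. x \<noteq> 0 \<longrightarrow> 0 < x \<bullet> W x)"

text \<open>
  In a well-formed graph the coboundary ignores coordinates outside \<^term>\<open>verts G\<close> and takes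
  values in \<^term>\<open>C1 G\<close>, so its adjoint on the ambient spaces restricts to the adjoint of
  \<open>\<delta> : C0 G \<rightarrow> C1 G\<close>.
\<close>

definition laplacian ::
    "('v::finite, 'e::finite) pre_digraph \<Rightarrow> ('n::finite, 'v, 'e) restrictions
      \<Rightarrow> (real^'n^'e \<Rightarrow> real^'n^'e) \<Rightarrow> real^'n^'v \<Rightarrow> real^'n^'v" where
  "laplacian G \<rho> W = adjoint (coboundary G \<rho>) \<circ> W \<circ> coboundary G \<rho>"

definition ker_laplacian ::
    "('v::finite, 'e::finite) pre_digraph \<Rightarrow> ('n::finite, 'v, 'e) restrictions
      \<Rightarrow> (real^'n^'e \<Rightarrow> real^'n^'e) \<Rightarrow> (real^'n^'v) set" where
  "ker_laplacian G \<rho> W = {z \<in> C0 G. laplacian G \<rho> W z = 0}"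


section \<open>Walks, parallel transport and holonomy\<close>

text \<open>
  Walks may traverse an edge in either direction. They are directed walks in the digraph
  whose arcs \<open>(e, True)\<close> and \<open>(e, False)\<close> are \<open>e\<close> traversed from tail to head and from head
  to tail; parallel edges remain distinct, which \<^const>\<open>mk_symmetric\<close> would not ensure.
\<close>

definition traversals :: "('v, 'e) pre_digraph \<Rightarrow> ('v, 'e \<times> bool) pre_digraph" where
  "traversals G =
     \<lparr> verts = verts G, arcs = arcs G \<times> UNIV,
       tail = (\<lambda>(e, fwd). if fwd then tail G e else head G e),
       head = (\<lambda>(e, fwd). if fwd then head G e else tail G e) \<rparr>"

definition edge_transport ::
    "('v, 'e) pre_digraph \<Rightarrow> ('n::finite, 'v, 'e) restrictions \<Rightarrow> 'e \<Rightarrow> real^'n^'n" where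
  "edge_transport G \<rho> e = matrix_inv (\<rho> (head G e) e) ** \<rho> (tail G e) e"

fun transport ::
    "('v, 'e) pre_digraph \<Rightarrow> ('n::finite, 'v, 'e) restrictions \<Rightarrow> ('e \<times> bool) list
      \<Rightarrow> real^'n^'n" where
  "transport G \<rho> [] = mat 1"
| "transport G \<rho> ((e, fwd) # p) =
     transport G \<rho> p **
     (if fwd then edge_transport G \<rho> e else matrix_inv (edge_transport G \<rho> e))"

definition orthogonal_group :: "(real^'n::finite^'n) monoid" where
  "orthogonal_group = \<lparr> carrier = {A. orthogonal_matrix A}, mult = (**), one = mat 1 \<rparr>"

definition Hol ::
    "('v, 'e) pre_digraph \<Rightarrow> ('n::finite, 'v, 'e) restrictions \<Rightarrow> 'v \<Rightarrow> (real^'n^'n) set" where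
  "Hol G \<rho> v =
     generate orthogonal_group {transport G \<rho> p | p. pre_digraph.awalk (traversals G) v p v}"

definition Fix :: "(real^'n::finite^'n) set \<Rightarrow> (real^'n) set" where
  "Fix H = {x. \<forall>A\<in>H. A *v x = x}"

text \<open>
  The length bound excludes loops, double edges, and going back and forth along one edge.
\<close>

definition single_cycle_graph :: "('v, 'e) pre_digraph \<Rightarrow> bool" where
  "single_cycle_graph G \<longleftrightarrow>
     (\<exists>p. pre_digraph.cycle (traversals G) p \<and> 3 \<le> length p \<and>
          fst ` set p = arcs G \<and> tail (traversals G) ` set p = verts G)"

definition num_components :: "('v, 'e) pre_digraph \<Rightarrow> nat" where
  "num_components G = card (pre_digraph.sccs_verts (with_proj (mk_symmetric G)))"

end

theory Submission
  imports Defs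
begin

text \<open>
  Since \<open>W\<close> is positive definite, \<open>\<langle>z, L z\<rangle> = \<langle>\<delta> z, W \<delta> z\<rangle>\<close> vanishes only for \<open>\<delta> z = 0\<close>, so
  the kernel of the Laplacian is the space of global sections. A section is determined by its
  value at \<open>v0\<close> through parallel transport, and this value is fixed by all holonomies.
  Conversely, a vector fixed by the holonomy group can be transported along arbitrary walks:
  two walks with the same ends differ by a closed walk, so the result is a section. Hence
  evaluation at \<open>v0\<close> is an isomorphism. The example is a triangle in which one restriction
  map is \<open>-1\<close>, which forces \<open>z = -z\<close> at every vertex.
\<close>

section \<open>Orthogonal matrices\<close>

text \<open>\<open>matrix_inv\<close> is a Hilbert choice, so the transpose first serves as a
  witness that a two-sided inverse exists; a left and a right inverse of \<open>A\<close> then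
  coincide.\<close>

lemma matrix_inv_orthogonal:
  fixes A :: "real^'n^'n"
  assumes "orthogonal_matrix A"
  shows "matrix_inv A = transpose A"
proof -
  have "A ** matrix_inv A = mat 1"
    using assms unfolding matrix_inv_def orthogonal_matrix_def
    by (metis (mono_tags, lifting) someI_ex)
  moreover have "transpose A ** A = mat 1"
    using assms by (simp add: orthogonal_matrix_def)
  ultimately show ?thesis
    by (metis matrix_mul_assoc matrix_mul_lid matrix_mul_rid)
qed

lemma orthogonal_matrix_vector_eq_iff:
  fixes A :: "real^'n^'n"
  assumes "orthogonal_matrix A"
  shows "A *v x = y \<longleftrightarrow> x = transpose A *v y"
  using assms unfolding orthogonal_matrix_def
  by (metis matrix_vector_mul_assoc matrix_vector_mul_lid)

lemma group_orthogonal_group: "group (orthogonal_group :: (real^'n::finite^'n) monoid)"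
proof (rule groupI)
  fix A :: "real^'n^'n"
  assume "A \<in> carrier orthogonal_group"
  then show "\<exists>B\<in>carrier orthogonal_group. B \<otimes>\<^bsub>orthogonal_group\<^esub> A = \<one>\<^bsub>orthogonal_group\<^esub>"
    by (intro bexI[of _ "transpose A"]) (auto simp: orthogonal_group_def orthogonal_matrix_def)
qed (auto simp: orthogonal_group_def orthogonal_matrix_mul matrix_mul_assoc orthogonal_matrix_id)

text \<open>The matrices fixing a given vector are closed under products and inverses. The carrier
  condition serves the inverse case, where the group inverse has to be an actual matrix
  inverse.\<close>

lemma Fix_generate:
  fixes S :: "(real^'n::finite^'n) set"
  assumes "S \<subseteq> carrier orthogonal_group"
  shows "Fix (generate orthogonal_group S) = Fix S"
proof
  show "Fix (generate orthogonal_group S) \<subseteq> Fix S"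
    unfolding Fix_def by (auto intro: generate.incl)
  show "Fix S \<subseteq> Fix (generate orthogonal_group S)"
  proof
    fix x assume x: "x \<in> Fix S"
    interpret group "orthogonal_group :: (real^'n^'n) monoid" by (rule group_orthogonal_group)
    have "A *v x = x" if "A \<in> generate orthogonal_group S" for A
      using that
    proof induction
      case one
      then show ?case by (simp add: orthogonal_group_def)
    next
      case (incl A)
      then show ?case using x by (simp add: Fix_def)
    next
      case (inv A)
      then have "inv\<^bsub>orthogonal_group\<^esub> A ** A = mat 1"
        using l_inv[of A] assms by (auto simp: orthogonal_group_def)
      moreover have "A *v x = x" using inv x by (simp add: Fix_def)
      ultimately show ?case
        by (metis matrix_vector_mul_assoc matrix_vector_mul_lid)
    next
      case (eng A B)
      then show ?case
        by (simp add: orthogonal_group_def flip: matrix_vector_mul_assoc)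
    qed
    then show "x \<in> Fix (generate orthogonal_group S)" by (simp add: Fix_def)
  qed
qed


section \<open>The kernel of the Laplacian\<close>

lemma linear_coboundary: "linear (coboundary G \<rho>)"
  by (rule linearI)
     (auto simp: coboundary_def vec_eq_iff matrix_vector_right_distrib
       matrix_vector_mult_scaleR algebra_simps)

lemma coboundary_in_C1: "coboundary G \<rho> z \<in> C1 G"
  by (simp add: coboundary_def C1_def)

lemma ker_laplacian_eq_global_sections:
  fixes G :: "('v::finite, 'e::finite) pre_digraph"
    and \<rho> :: "('n::finite, 'v, 'e) restrictions"
  assumes W: "pos_def_on_C1 G W"
  shows "ker_laplacian G \<rho> W = global_sections G \<rho>"
proof -
  let ?d = "coboundary G \<rho>"
  have "laplacian G \<rho> W z = 0 \<longleftrightarrow> ?d z = 0" for z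
  proof
    assume "laplacian G \<rho> W z = 0"
    then have "?d z \<bullet> W (?d z) = 0"
      using adjoint_works[OF linear_coboundary[of G \<rho>], of z "W (?d z)"]
      by (simp add: laplacian_def)
    \<comment> \<open>Definiteness of \<open>W\<close> is available only on \<open>C1 G\<close>, and
      the coboundary lands there.\<close>
    then show "?d z = 0"
      using W coboundary_in_C1[of G \<rho> z] by (force simp: pos_def_on_C1_def)
  next
    assume "?d z = 0"
    moreover have "linear W" using W by (simp add: pos_def_on_C1_def)
    ultimately show "laplacian G \<rho> W z = 0"
      by (simp add: laplacian_def linear_0 adjoint_linear linear_coboundary)
  qed
  then show ?thesis by (simp add: ker_laplacian_def global_sections_def)
qed

lemma subspace_global_sections: "subspace (global_sections G \<rho>)"
  using linear_coboundary[of G \<rho>]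
  by (auto simp: subspace_def global_sections_def C0_def linear_0 linear_add linear_scale)

text \<open>Both dimension counts below apply this to a map that evaluates sections at selected
  vertices.\<close>

lemma dim_image_subspace:
  fixes f :: "'a::euclidean_space \<Rightarrow> 'b::euclidean_space"
  assumes "linear f" "subspace S" "\<And>x. x \<in> S \<Longrightarrow> f x = 0 \<Longrightarrow> x = 0"
  shows "dim (f ` S) = dim S"
proof (rule dim_image_eq)
  show "inj_on f (span S)"
    using assms by (simp add: linear_inj_on_iff_eq_0 subspace_span span_eq_iff[THEN iffD2])
qed fact


section \<open>Walks and transport\<close>

lemma traversals_simps [simp]:
  "verts (traversals G) = verts G"
  "(e, b) \<in> arcs (traversals G) \<longleftrightarrow> e \<in> arcs G"
  "tail (traversals G) (e, b) = (if b then tail G e else head G e)"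
  "head (traversals G) (e, b) = (if b then head G e else tail G e)"
  by (auto simp: traversals_def)

text \<open>Connectedness is phrased with \<open>mk_symmetric\<close>, which merges parallel edges.
  Reachability depends only on the adjacency relation, and that is the same for both
  digraphs.\<close>

lemma arcs_ends_traversals: "arcs_ends (traversals G) = parcs (mk_symmetric G)"
proof -
  have "arcs (traversals G) = (\<Union>e\<in>arcs G. {(e, True), (e, False)})"
    by (auto simp: traversals_def)
  then show ?thesis by (simp add: arcs_ends_conv parcs_mk_symmetric image_UN)
qed

lemma reachable_traversals:
  "u \<rightarrow>\<^sup>*\<^bsub>traversals G\<^esub> v \<longleftrightarrow> u \<rightarrow>\<^sup>*\<^bsub>with_proj (mk_symmetric G)\<^esub> v"
  by (simp add: reachable_def arcs_ends_traversals)

section \<open>Composition and reversal of walks\<close>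

definition reverse_walk :: "('e \<times> bool) list \<Rightarrow> ('e \<times> bool) list" where
  "reverse_walk p = rev (map (\<lambda>(e, b). (e, \<not> b)) p)"

text \<open>Matrices act on column vectors from the left, so the part traversed later becomes the
  left factor.\<close>

lemma transport_append: "transport G \<rho> (p @ q) = transport G \<rho> q ** transport G \<rho> p"
  by (induction p) (auto simp: matrix_mul_assoc)

locale orthogonal_sheaf_on_graph = fin_digraph G
  for G :: "('v::finite, 'e::finite) pre_digraph" +
  fixes \<rho> :: "('n::finite, 'v, 'e) restrictions"
  assumes orthogonal_sheaf: "orthogonal_sheaf G \<rho>"
begin

sublocale T: wf_digraph "traversals G"
  by unfold_locales (auto simp: traversals_def)

sublocale M: wf_digraph "with_proj (mk_symmetric G)"
  by unfold_locales (auto simp: parcs_mk_symmetric)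

lemma T_awalk_iff_reachable:
  "(\<exists>p. T.awalk u p v) \<longleftrightarrow> u \<rightarrow>\<^sup>*\<^bsub>with_proj (mk_symmetric G)\<^esub> v"
  by (simp add: T.reachable_awalk flip: reachable_traversals)

lemma orthogonal_edge_transport:
  assumes "e \<in> arcs G"
  shows "orthogonal_matrix (edge_transport G \<rho> e)"
  using orthogonal_sheaf assms
  by (auto simp: edge_transport_def orthogonal_sheaf_def matrix_inv_orthogonal
      intro!: orthogonal_matrix_mul)

lemma orthogonal_transport:
  "set p \<subseteq> arcs (traversals G) \<Longrightarrow> orthogonal_matrix (transport G \<rho> p)"
  by (induction p)
     (auto simp: orthogonal_matrix_id orthogonal_edge_transport matrix_inv_orthogonal
       intro!: orthogonal_matrix_mul)

text \<open>Reversal inverts each factor and reverses their order, exactly as transposition does for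
  a product of orthogonal matrices.\<close>

lemma transport_reverse_walk:
  "set p \<subseteq> arcs (traversals G) \<Longrightarrow>
    transport G \<rho> (reverse_walk p) = transpose (transport G \<rho> p)"
proof (induction p)
  case Nil
  then show ?case by (simp add: reverse_walk_def)
next
  case (Cons a p)
  obtain e b where a: "a = (e, b)" by (cases a)
  have "transport G \<rho> (reverse_walk (a # p)) =
      transport G \<rho> [(e, \<not> b)] ** transport G \<rho> (reverse_walk p)"
    by (simp add: reverse_walk_def transport_append a)
  then show ?case
    using Cons a
    by (simp add: matrix_transpose_mul matrix_inv_orthogonal orthogonal_edge_transport)
qed

lemma awalk_reverse_walk: "T.awalk u p v \<Longrightarrow> T.awalk v (reverse_walk p) u"
proof (induction p arbitrary: u)
  case Nil
  then show ?case by (auto simp: reverse_walk_def T.awalk_Nil_iff)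
next
  case (Cons a p)
  obtain e b where a: "a = (e, b)" by (cases a)
  from Cons have "T.awalk v (reverse_walk p) (head (traversals G) a)"
    by (simp add: T.awalk_Cons_iff)
  moreover have "T.awalk (head (traversals G) a) [(e, \<not> b)] u"
    using Cons.prems by (auto simp: T.awalk_Cons_iff T.awalk_Nil_iff a)
  ultimately show ?case
    using T.awalk_appendI by (fastforce simp: reverse_walk_def a)
qed

section \<open>Sections and parallel transport\<close>

lemma global_sections_iff:
  "z \<in> global_sections G \<rho> \<longleftrightarrow>
    z \<in> C0 G \<and> (\<forall>e\<in>arcs G. z $ head G e = edge_transport G \<rho> e *v z $ tail G e)"
proof -
  have "\<rho> (head G e) e *v z $ head G e = \<rho> (tail G e) e *v z $ tail G e \<longleftrightarrow>
      z $ head G e = edge_transport G \<rho> e *v z $ tail G e" if "e \<in> arcs G" for e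
    using orthogonal_sheaf that
    by (simp add: orthogonal_matrix_vector_eq_iff orthogonal_sheaf_def edge_transport_def
        matrix_inv_orthogonal flip: matrix_vector_mul_assoc)
  then show ?thesis
    by (auto simp: global_sections_def coboundary_def vec_eq_iff[of "\<chi> e. _ e"])
qed

lemma section_transport:
  assumes z: "z \<in> global_sections G \<rho>" and "T.awalk u p v"
  shows "z $ v = transport G \<rho> p *v z $ u"
  using assms(2)
proof (induction p arbitrary: u)
  case Nil
  then show ?case by (simp add: T.awalk_Nil_iff)
next
  case (Cons a p)
  obtain e b where a: "a = (e, b)" by (cases a)
  have e: "e \<in> arcs G" using Cons.prems by (simp add: a T.awalk_Cons_iff)
  have "z $ head (traversals G) a = transport G \<rho> [a] *v z $ u"
  proof (cases b)
    case True
    then show ?thesis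
      using z e Cons.prems by (simp add: a T.awalk_Cons_iff global_sections_iff)
  next
    case False
    \<comment> \<open>Backwards along \<open>e\<close>, the section condition is solved for the tail
      value by orthogonality.\<close>
    have "edge_transport G \<rho> e *v z $ tail G e = z $ head G e"
      using z e by (simp add: global_sections_iff)
    with False show ?thesis
      using e Cons.prems
      by (simp add: a T.awalk_Cons_iff orthogonal_matrix_vector_eq_iff
          orthogonal_edge_transport matrix_inv_orthogonal)
  qed
  moreover have "z $ v = transport G \<rho> p *v z $ head (traversals G) a"
    using Cons by (simp add: T.awalk_Cons_iff)
  ultimately show ?case
    by (simp add: a matrix_vector_mul_assoc)
qed

section \<open>Vectors fixed by the holonomy group\<close>

lemma Fix_Hol: "Fix (Hol G \<rho> v) = {x. \<forall>p. T.awalk v p v \<longrightarrow> transport G \<rho> p *v x = x}"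
proof -
  have "{transport G \<rho> p | p. T.awalk v p v} \<subseteq> carrier orthogonal_group"
    using orthogonal_transport by (auto simp: orthogonal_group_def T.awalk_def)
  then show ?thesis
    unfolding Hol_def by (subst Fix_generate) (auto simp: Fix_def)
qed

text \<open>Path independence: going out along \<open>p\<close> and back along \<open>q\<close> is a
  closed walk, so its transport fixes \<open>x\<close>; the return factor is then moved to the other
  side.\<close>

lemma transport_Fix_Hol:
  assumes "x \<in> Fix (Hol G \<rho> v0)" "T.awalk v0 p v" "T.awalk v0 q v"
  shows "transport G \<rho> p *v x = transport G \<rho> q *v x"
proof -
  have "T.awalk v0 (p @ reverse_walk q) v0"
    using assms awalk_reverse_walk T.awalk_appendI by blast
  then have "transport G \<rho> (p @ reverse_walk q) *v x = x"
    using assms(1) by (simp add: Fix_Hol)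
  moreover have q: "set q \<subseteq> arcs (traversals G)"
    using assms(3) by (simp add: T.awalk_def)
  ultimately have "x = transpose (transport G \<rho> q) *v (transport G \<rho> p *v x)"
    by (simp add: transport_append transport_reverse_walk matrix_vector_mul_assoc)
  then show ?thesis
    using q orthogonal_matrix_vector_eq_iff orthogonal_transport by metis
qed

lemma section_extending:
  assumes conn: "\<And>v. v \<in> verts G \<Longrightarrow> \<exists>p. T.awalk v0 p v"
    and v0: "v0 \<in> verts G" and x: "x \<in> Fix (Hol G \<rho> v0)"
  obtains z where "z \<in> global_sections G \<rho>" "z $ v0 = x"
proof
  define walk where "walk v = (SOME p. T.awalk v0 p v)" for v
  define z where "z = (\<chi> v. if v \<in> verts G then transport G \<rho> (walk v) *v x else 0)"
  have walk: "T.awalk v0 (walk v) v" if "v \<in> verts G" for v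
    using conn[OF that] unfolding walk_def by (rule someI_ex)
  \<comment> \<open>By path independence any walk may replace the chosen one: the empty walk gives
    the value at \<open>v0\<close>, and the chosen walk to a tail extended by its edge gives the
    section condition.\<close>
  have z: "z $ v = transport G \<rho> p *v x" if "T.awalk v0 p v" for p v
    using transport_Fix_Hol[OF x that walk] T.awalk_last_in_verts[OF that]
    by (simp add: z_def)
  show "z $ v0 = x"
    using z[of "[]" v0] v0 by (simp add: T.awalk_Nil_iff)
  have "z $ head G e = edge_transport G \<rho> e *v z $ tail G e" if e: "e \<in> arcs G" for e
  proof -
    have "T.awalk v0 (walk (tail G e) @ [(e, True)]) (head G e)"
      using e walk[of "tail G e"]
      by (intro T.awalk_appendI) (auto simp: T.awalk_Cons_iff T.awalk_Nil_iff)
    from z[OF this] show ?thesis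
      using e by (simp add: transport_append z_def matrix_vector_mul_assoc)
  qed
  then show "z \<in> global_sections G \<rho>"
    by (simp add: global_sections_iff C0_def z_def)
qed

lemma dim_global_sections_connected:
  assumes "Digraph_Component.connected G" and v0: "v0 \<in> verts G"
  shows "dim (global_sections G \<rho>) = dim (Fix (Hol G \<rho> v0))"
proof -
  have conn: "\<exists>p. T.awalk v0 p v" if "v \<in> verts G" for v
    using assms that
    by (auto simp: Digraph_Component.connected_def strongly_connected_def T_awalk_iff_reachable)
  have "(\<lambda>z. z $ v0) ` global_sections G \<rho> = Fix (Hol G \<rho> v0)"
  proof (intro equalityI subsetI)
    fix x assume "x \<in> (\<lambda>z. z $ v0) ` global_sections G \<rho>"
    then show "x \<in> Fix (Hol G \<rho> v0)"
      by (auto simp: Fix_Hol simp flip: section_transport)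
  next
    fix x assume "x \<in> Fix (Hol G \<rho> v0)"
    then obtain z where "z \<in> global_sections G \<rho>" "z $ v0 = x"
      using conn v0 section_extending by blast
    then show "x \<in> (\<lambda>z. z $ v0) ` global_sections G \<rho>" by blast
  qed
  \<comment> \<open>Evaluation is injective: a section vanishing at \<open>v0\<close> vanishes at
    every vertex by transport, and off \<open>verts G\<close> by membership in
    \<open>C0 G\<close>.\<close>
  moreover have "dim ((\<lambda>z. z $ v0) ` global_sections G \<rho>) = dim (global_sections G \<rho>)"
  proof (rule dim_image_subspace[OF _ subspace_global_sections])
    show "linear (\<lambda>z::real^'n^'v. z $ v0)" by (simp add: linear_iff)
    fix z assume z: "z \<in> global_sections G \<rho>" "z $ v0 = 0"
    have "z $ v = 0" for v
    proof (cases "v \<in> verts G")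
      case True
      then show ?thesis using conn section_transport[OF z(1)] z(2) by fastforce
    next
      case False
      then show ?thesis using z(1) by (simp add: global_sections_iff C0_def)
    qed
    then show "z = 0" by (simp add: vec_eq_iff)
  qed
  ultimately show ?thesis by simp
qed

end


section \<open>Trivial holonomy\<close>

lemma Fix_trivial: "Fix {mat 1} = UNIV"
  by (simp add: Fix_def)

text \<open>The map \<open>b\<close> indexes the standard basis by pairs of a vertex and a
  coordinate; the space is spanned by the basis vectors whose vertex lies in
  \<open>R\<close>.\<close>

lemma dim_supported_on:
  fixes R :: "'v::finite set"
  shows "dim {y :: real^'n::finite^'v. \<forall>v. v \<notin> R \<longrightarrow> y $ v = 0} = CARD('n) * card R"
proof -
  define b :: "'v \<times> 'n \<Rightarrow> real^'n^'v" where "b = (\<lambda>(v, i). axis v (axis i 1))"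
  have inj: "inj b"
    by (auto simp: inj_on_def b_def axis_eq_axis)
  have Basis: "Basis = range b"
    by (auto simp: b_def Basis_vec_def image_iff)
  have inner: "y \<bullet> b (v, i) = y $ v $ i" for y v i
    by (simp add: b_def inner_axis)
  have "{y. \<forall>v. v \<notin> R \<longrightarrow> y $ v = 0} =
      {y. \<forall>c\<in>Basis. c \<notin> b ` (R \<times> UNIV) \<longrightarrow> y \<bullet> c = 0}"
    by (auto simp: Basis inj_image_mem_iff[OF inj] inner vec_eq_iff)
  also have "dim \<dots> = card (b ` (R \<times> UNIV))"
    by (rule dim_substandard) (auto simp: Basis)
  also have "\<dots> = CARD('n) * card R"
    by (simp add: card_image inj_on_subset[OF inj] card_cartesian_product)
  finally show ?thesis .
qed

context orthogonal_sheaf_on_graph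
begin

context
  assumes identity: "identity_sheaf G \<rho>"
begin

lemma edge_transport_identity: "e \<in> arcs G \<Longrightarrow> edge_transport G \<rho> e = mat 1"
  using identity
  by (simp add: edge_transport_def identity_sheaf_def matrix_inv_orthogonal orthogonal_matrix_id)

lemma transport_identity: "set p \<subseteq> arcs (traversals G) \<Longrightarrow> transport G \<rho> p = mat 1"
  by (induction p)
     (auto simp: edge_transport_identity matrix_inv_orthogonal orthogonal_matrix_id)

lemma Hol_identity:
  assumes "v \<in> verts G"
  shows "Hol G \<rho> v = {mat 1}"
proof -
  \<comment> \<open>The empty walk makes the generating set a singleton rather than empty.\<close>
  have "T.awalk v [] v" using assms by (simp add: T.awalk_Nil_iff)
  moreover have "transport G \<rho> p = mat 1" if "T.awalk v p v" for p
    using that transport_identity by (simp add: T.awalk_def)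
  ultimately have "{transport G \<rho> p | p. T.awalk v p v} = {\<one>\<^bsub>orthogonal_group\<^esub>}"
    unfolding orthogonal_group_def by force
  then show ?thesis
    using group.generate_one[OF group_orthogonal_group]
    by (simp add: Hol_def) (simp add: orthogonal_group_def)
qed

text \<open>
  A section is constant on components, so it is determined by its values at one chosen
  representative of each component, and these values are arbitrary.
\<close>

lemma dim_global_sections_identity:
  "dim (global_sections G \<rho>) = CARD('n) * num_components G"
proof -
  define rep where "rep S = (SOME v. v \<in> S)" for S :: "'v set"
  define R where "R = rep ` M.sccs_verts"
  define F :: "real^'n^'v \<Rightarrow> real^'n^'v" where "F z = (\<chi> v. if v \<in> R then z $ v else 0)" for z
  have rep_in: "rep S \<in> S" if "S \<in> M.sccs_verts" for S
    using that unfolding rep_def M.in_sccs_verts_conv_reachable by (simp add: some_in_eq)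
  \<comment> \<open>Distinct components are disjoint, so they have distinct representatives.\<close>
  have "inj_on rep M.sccs_verts"
    using rep_in M.sccs_verts_disjoint by (metis disjoint_iff inj_onI)
  then have card_R: "card R = num_components G"
    by (simp add: R_def num_components_def card_image)
  have sym: "v \<rightarrow>\<^sup>*\<^bsub>with_proj (mk_symmetric G)\<^esub> u"
    if "u \<rightarrow>\<^sup>*\<^bsub>with_proj (mk_symmetric G)\<^esub> v" for u v
    using symmetric_reachable[OF symmetric_mk_symmetric that] .
  have rep_scc: "M.scc_of v \<in> M.sccs_verts" "rep (M.scc_of v) \<in> R"
    "rep (M.scc_of v) \<rightarrow>\<^sup>*\<^bsub>with_proj (mk_symmetric G)\<^esub> v" if "v \<in> verts G" for v
    using that M.scc_of_in_sccs_verts[of v] rep_in[of "M.scc_of v"]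
    by (auto simp: R_def M.scc_of_def)
  have rep_R: "rep (M.scc_of v) = v" "v \<in> verts G" if "v \<in> R" for v
  proof -
    obtain S where S: "S \<in> M.sccs_verts" "v = rep S" using \<open>v \<in> R\<close> by (auto simp: R_def)
    show "v \<in> verts G" using rep_in[OF S(1)] M.sccs_verts_subsets[OF S(1)] S(2) by auto
    then have "v \<in> M.scc_of v" "M.scc_of v \<in> M.sccs_verts"
      using M.in_scc_of_self M.scc_of_in_sccs_verts by auto
    then have "M.scc_of v = S"
      using S rep_in M.sccs_verts_disjoint by blast
    then show "rep (M.scc_of v) = v" using S by simp
  qed
  have const: "z $ v = z $ u"
    if z: "z \<in> global_sections G \<rho>" and uv: "u \<rightarrow>\<^sup>*\<^bsub>with_proj (mk_symmetric G)\<^esub> v" for z u v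
  proof -
    obtain p where p: "T.awalk u p v" using uv T_awalk_iff_reachable by blast
    then show ?thesis
      using section_transport[OF z p] transport_identity[of p] by (simp add: T.awalk_def)
  qed
  have "F ` global_sections G \<rho> = {y. \<forall>v. v \<notin> R \<longrightarrow> y $ v = 0}"
  proof (intro equalityI subsetI)
    fix y assume "y \<in> F ` global_sections G \<rho>"
    then show "y \<in> {y. \<forall>v. v \<notin> R \<longrightarrow> y $ v = 0}" by (auto simp: F_def)
  next
    fix y :: "real^'n^'v" assume y: "y \<in> {y. \<forall>v. v \<notin> R \<longrightarrow> y $ v = 0}"
    \<comment> \<open>A preimage of \<open>y\<close>: the value at each representative is spread
      over its component. Both ends of an edge share a component, so this is a section.\<close>
    define z where "z = (\<chi> v. if v \<in> verts G then y $ rep (M.scc_of v) else 0)"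
    have "M.scc_of (head G e) = M.scc_of (tail G e)" if "e \<in> arcs G" for e
    proof -
      have "tail G e \<rightarrow>\<^sup>*\<^bsub>with_proj (mk_symmetric G)\<^esub> head G e"
        using that by (intro reachable_mk_symmetricI reachable_adjI in_arcs_imp_in_arcs_ends)
      then have "head G e \<rightarrow>\<^sup>*\<^bsub>with_proj (mk_symmetric G)\<^esub> w \<longleftrightarrow>
          tail G e \<rightarrow>\<^sup>*\<^bsub>with_proj (mk_symmetric G)\<^esub> w" for w
        by (metis M.reachable_trans sym)
      then show ?thesis
        unfolding M.scc_of_def by (metis sym)
    qed
    then have "z \<in> global_sections G \<rho>"
      by (simp add: global_sections_iff C0_def z_def edge_transport_identity)
    moreover have "F z = y"
      using y rep_R by (auto simp: F_def z_def vec_eq_iff)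
    ultimately show "y \<in> F ` global_sections G \<rho>" by blast
  qed
  moreover have "dim (F ` global_sections G \<rho>) = dim (global_sections G \<rho>)"
  proof (rule dim_image_subspace[OF _ subspace_global_sections])
    show "linear F" by (auto simp: F_def linear_iff vec_eq_iff)
    fix z assume z: "z \<in> global_sections G \<rho>" "F z = 0"
    have "z $ v = 0" for v
    proof (cases "v \<in> verts G")
      case True
      have "z $ v = z $ rep (M.scc_of v)" by (rule const[OF z(1) rep_scc(3)[OF True]])
      also have "\<dots> = F z $ rep (M.scc_of v)" using rep_scc(2)[OF True] by (simp add: F_def)
      finally show ?thesis using z(2) by simp
    next
      case False
      then show ?thesis using z(1) by (simp add: global_sections_iff C0_def)
    qed
    then show "z = 0" by (simp add: vec_eq_iff)
  qed
  ultimately show ?thesis using dim_supported_on[of R, where 'n='n] card_R by simp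
qed

end

end


section \<open>A triangle with holonomy \<open>-1\<close>\<close>

text \<open>In the type \<^typ>\<open>3\<close> one has \<open>3 = 0\<close>, so the arcs \<open>1\<close>, \<open>2\<close>, \<open>3\<close> form an oriented triangle.\<close>

definition triangle :: "(3, 3) pre_digraph" where
  "triangle = \<lparr> verts = UNIV, arcs = UNIV, tail = (\<lambda>e. e), head = (\<lambda>e. e + 1) \<rparr>"

text \<open>The only sign sits at the head of the arc \<open>3\<close>, since
  \<open>3 + 1 = 1\<close> in this type.\<close>

definition twisted :: "('n::finite, 3, 3) restrictions" where
  "twisted v e = (if e = 3 \<and> v = 1 then - mat 1 else mat 1)"

lemma triangle_simps [simp]:
  "verts triangle = UNIV" "arcs triangle = UNIV" "tail triangle e = e" "head triangle e = e + 1"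
  by (simp_all add: triangle_def)

lemma minus_mat_1_mult [simp]: "(- mat 1 :: real^'n^'n) *v x = - x"
  by (simp add: vec_eq_iff matrix_vector_mult_def mat_def sum_negf sum.delta
      if_distrib[of "\<lambda>c. c * _"] if_distrib[of uminus] cong: if_cong)

lemma orthogonal_twisted: "orthogonal_matrix (twisted v e :: real^'n::finite^'n)"
proof -
  have "transpose (- mat 1) = (- mat 1 :: real^'n^'n)"
    by (simp add: transpose_def mat_def vec_eq_iff)
  moreover have "(- mat 1) ** (- mat 1) = (mat 1 :: real^'n^'n)"
    by (simp add: matrix_eq flip: matrix_vector_mul_assoc)
  ultimately have "orthogonal_matrix (- mat 1 :: real^'n^'n)"
    by (simp add: orthogonal_matrix)
  then show ?thesis by (simp add: twisted_def orthogonal_matrix_id)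
qed

interpretation triangle: orthogonal_sheaf_on_graph triangle twisted
  by unfold_locales (auto simp: orthogonal_sheaf_def orthogonal_twisted)

lemma awalk_triangle: "triangle.T.awalk 1 [(1, True), (2, True), (3, True)] 1"
  by (simp add: triangle.T.awalk_Cons_iff triangle.T.awalk_Nil_iff)

lemma single_cycle_triangle: "single_cycle_graph triangle"
proof -
  let ?p = "[(1::3, True), (2, True), (3, True)]"
  have "triangle.T.cycle ?p"
    unfolding triangle.T.cycle_def using awalk_triangle by (intro exI[of _ 1]) simp
  moreover have "fst ` set ?p = arcs triangle"
    "tail (traversals triangle) ` set ?p = verts triangle"
    by (auto simp: UNIV_3)
  ultimately show ?thesis
    unfolding single_cycle_graph_def by (intro exI[of _ ?p]) simp
qed

lemma connected_triangle: "Digraph_Component.connected triangle"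
proof -
  have "triangle.T.awalk 1 [] 1" "triangle.T.awalk 1 [(1, True)] 2"
    "triangle.T.awalk 1 [(1, True), (2, True)] 3"
    by (simp_all add: triangle.T.awalk_Cons_iff triangle.T.awalk_Nil_iff)
  then have from_1: "\<exists>p. triangle.T.awalk 1 p v" for v
    using exhaust_3[of v] by blast
  \<comment> \<open>Any two vertices are joined through \<open>1\<close>, by reversing a walk from
    \<open>1\<close> to \<open>u\<close>.\<close>
  then have "\<exists>p. triangle.T.awalk u p v" for u v
    using triangle.awalk_reverse_walk triangle.T.awalk_appendI by meson
  then show ?thesis
    by (simp add: Digraph_Component.connected_def strongly_connected_def
        triangle.T_awalk_iff_reachable)
qed

lemma global_sections_triangle:
  "global_sections triangle (twisted :: ('n::finite, 3, 3) restrictions) = {0}"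
proof -
  have "z = 0" if "z \<in> global_sections triangle twisted" for z :: "real^'n^3"
  proof -
    have "(4::3) = 1" by simp
    have "twisted (e + 1) e *v z $ (e + 1) = twisted e e *v z $ e" for e
      using that by (simp add: global_sections_def coboundary_def vec_eq_iff)
    \<comment> \<open>Once around the triangle, the value at \<open>1\<close> becomes its own
      negative.\<close>
    from this[of 1] this[of 2] this[of 3]
    have "z $ 2 = z $ 1" "z $ 3 = z $ 2" "- z $ 1 = z $ 3"
      using \<open>(4::3) = 1\<close> by (simp_all add: twisted_def)
    then show ?thesis
      by (auto simp: vec_eq_iff forall_3)
  qed
  then show ?thesis
    using subspace_0[OF subspace_global_sections] by blast
qed

text \<open>No holonomy is computed: a trivial group would fix all of the stalk, whose dimension is
  positive, whereas the only section is zero.\<close>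

lemma Hol_triangle: "Hol triangle (twisted :: ('n::finite, 3, 3) restrictions) v \<noteq> {mat 1}"
proof
  let ?\<rho> = "twisted :: ('n, 3, 3) restrictions"
  assume "Hol triangle ?\<rho> v = {mat 1}"
  then have "dim (Fix (Hol triangle ?\<rho> v)) = CARD('n)"
    by (simp add: Fix_trivial)
  moreover have "dim (global_sections triangle ?\<rho>) = dim (Fix (Hol triangle ?\<rho> v))"
    by (rule triangle.dim_global_sections_connected[OF connected_triangle]) simp
  ultimately show False
    by (simp add: global_sections_triangle)
qed

theorem proposition4p2:
  fixes G :: "('v::finite, 'e::finite) pre_digraph"
    and \<rho> :: "('n::finite, 'v, 'e) restrictions"
    and W :: "real^'n^'e \<Rightarrow> real^'n^'e"
    and v0 :: 'v
  assumes "fin_digraph G"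
    and "orthogonal_sheaf G \<rho>"
    and "pos_def_on_C1 G W"
  shows
    "(Digraph_Component.connected G \<and> v0 \<in> verts G \<longrightarrow>
        dim (ker_laplacian G \<rho> W) = dim (Fix (Hol G \<rho> v0)))
     \<and>
     (identity_sheaf G \<rho> \<longrightarrow>
        (\<forall>v\<in>verts G. Hol G \<rho> v = {mat 1}) \<and>
        (Digraph_Component.connected G \<longrightarrow> dim (ker_laplacian G \<rho> W) = CARD('n)) \<and>
        dim (ker_laplacian G \<rho> W) = CARD('n) * num_components G)
     \<and>
     (\<exists>(G' :: (3, 3) pre_digraph) (\<rho>' :: ('n, 3, 3) restrictions).
        fin_digraph G' \<and> Digraph_Component.connected G' \<and> single_cycle_graph G' \<and>
        orthogonal_sheaf G' \<rho>' \<and>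
        (\<forall>v\<in>verts G'. Hol G' \<rho>' v \<noteq> {mat 1}) \<and>
        global_sections G' \<rho>' = {0} \<and>
        (\<forall>W'. pos_def_on_C1 G' W' \<longrightarrow> dim (ker_laplacian G' \<rho>' W') = 0))"
proof (intro conjI impI)
  interpret fin_digraph G by fact
  interpret orthogonal_sheaf_on_graph G \<rho> by unfold_locales fact
  have ker: "ker_laplacian G \<rho> W = global_sections G \<rho>"
    using assms(3) by (rule ker_laplacian_eq_global_sections)
  show "dim (ker_laplacian G \<rho> W) = dim (Fix (Hol G \<rho> v0))"
    if "Digraph_Component.connected G \<and> v0 \<in> verts G"
    using that dim_global_sections_connected by (simp add: ker)
  assume id: "identity_sheaf G \<rho>"
  show "\<forall>v\<in>verts G. Hol G \<rho> v = {mat 1}"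
    using Hol_identity[OF id] by blast
  show "dim (ker_laplacian G \<rho> W) = CARD('n) * num_components G"
    using dim_global_sections_identity[OF id] by (simp add: ker)
  assume conn: "Digraph_Component.connected G"
  \<comment> \<open>Connectedness includes having a vertex, which supplies the base point.\<close>
  then obtain v where "v \<in> verts G"
    by (auto simp: Digraph_Component.connected_def strongly_connected_def)
  then show "dim (ker_laplacian G \<rho> W) = CARD('n)"
    using dim_global_sections_connected[OF conn] Hol_identity[OF id]
    by (simp add: ker Fix_trivial)
next
  show "\<exists>(G' :: (3, 3) pre_digraph) (\<rho>' :: ('n, 3, 3) restrictions).
      fin_digraph G' \<and> Digraph_Component.connected G' \<and> single_cycle_graph G' \<and>
      orthogonal_sheaf G' \<rho>' \<and>
      (\<forall>v\<in>verts G'. Hol G' \<rho>' v \<noteq> {mat 1}) \<and>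
      global_sections G' \<rho>' = {0} \<and>
      (\<forall>W'. pos_def_on_C1 G' W' \<longrightarrow> dim (ker_laplacian G' \<rho>' W') = 0)"
    using triangle.fin_digraph_axioms connected_triangle single_cycle_triangle
      triangle.orthogonal_sheaf[where 'a='n] Hol_triangle[where 'n='n]
      global_sections_triangle[where 'n='n]
    by (intro exI[of _ triangle] exI[of _ twisted])
       (simp add: ker_laplacian_eq_global_sections)
qed

end
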